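(* For sufficiently large $U$, the competitive ratio of the deterministic online algorithm Wait-and-Match (\textsc{Wam}) for the Restricted OWNM problem with weights in $[1,U]$ is $\Omega\!\left(2^{-2\sqrt{\log U}}\right)$.
   Context: Restricted OWNM: points $p_1,\dots,p_{2n}$ in general position in the plane arrive online with weights $w(p_i)\in[1,U]$ ($U$ known in advance); on arrival a point is irrevocably left unmatched or matched with a previously arrived unmatched point, so that the segments joining matched pairs are pairwise non-crossing. The profit $\textsc{ALG}(I)$ is the total weight of matched points; $\textsc{OPT}(I)=\sum_i w(p_i)$. An algorithm is $\rho$-competitive if there is a constant $c$ (possibly depending on $U$) with $\textsc{ALG}(I)\ge \rho\,\textsc{OPT}(I)-c$ for all $I$; the competitive ratio is the supremum of such $\rho$. All points lie in a bounding box $B$. $\log$ is base 2. Point classification: let $k=\lceil\sqrt{\log U}\rceil$, $r=U^{1/k}$ and $a_i=r^i$ for $i=0,\dots,k$. A point of weight $w$ has type $i$ if $a_i$ is the largest $a_j$ with $a_j\le w$. Algorithm \textsc{Wam}: it maintains a partition of $B$ into convex regions, initially just $B$. When two points in a region $R$ are matched, the segment between them is extended to the boundary of $R$, splitting $R$ into two convex regions. When a point $p$ arrives in region $R$, the algorithm considers the unmatched points of $R$ in non-increasing order of weight; for the currently considered point $q$, let $i$ be the maximum of the types of $p$ and $q$; $p$ is matched with $q$ (and the algorithm stops considering) if there are at least $2^{k-i}-1$ unmatched points on each side of the line $\overline{pq}$ (within $R$). If no such $q$ is found, $p$ is left unmatched. *)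

theory Defs
  imports "HOL-Analysis.Analysis" "HOL-Library.Landau_Symbols"
begin

section \<open>The Restricted OWNM problem\<close>

type_synonym point = "real ^ 2"

type_synonym item = "point \<times> real"

abbreviation pos :: "item \<Rightarrow> point" where "pos \<equiv> fst"
abbreviation weight :: "item \<Rightarrow> real" where "weight \<equiv> snd"

text \<open>A matching consists of the pairs (earlier point, later point).\<close>

type_synonym matching = "(item \<times> item) set"

definition general_position :: "point set \<Rightarrow> bool" where
  "general_position P \<longleftrightarrow>
     (\<forall>a\<in>P. \<forall>b\<in>P. \<forall>c\<in>P. a \<noteq> b \<and> a \<noteq> c \<and> b \<noteq> c \<longrightarrow> \<not> collinear {a, b, c})"

definition is_box :: "point set \<Rightarrow> bool" where
  "is_box B \<longleftrightarrow> (\<exists>l h. B = cbox l h)"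

text \<open>Sequences that can have been revealed at some moment; those of even length are the
  complete inputs.\<close>

definition admissible :: "real \<Rightarrow> point set \<Rightarrow> item list \<Rightarrow> bool" where
  "admissible U B xs \<longleftrightarrow>
     is_box B \<and> distinct (map pos xs) \<and> general_position (pos ` set xs) \<and>
     (\<forall>x\<in>set xs. pos x \<in> B \<and> weight x \<in> {1..U})"

definition input :: "real \<Rightarrow> point set \<Rightarrow> item list \<Rightarrow> bool" where
  "input U B xs \<longleftrightarrow> admissible U B xs \<and> even (length xs)"

definition non_crossing :: "matching \<Rightarrow> bool" where
  "non_crossing M \<longleftrightarrow>
     pairwise (\<lambda>(a, b) (c, d).
       closed_segment (pos a) (pos b) \<inter> closed_segment (pos c) (pos d) = {}) M"

text \<open>A deterministic algorithm (for a fixed, known \<open>U\<close>) maps the bounding box and the sequence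
  revealed so far to the current matching; being online means that each arrival adds
  at most one pair, which joins the new point to a previously unmatched one.\<close>

type_synonym algorithm = "point set \<Rightarrow> item list \<Rightarrow> matching"

definition online_algorithm :: "real \<Rightarrow> algorithm \<Rightarrow> bool" where
  "online_algorithm U A \<longleftrightarrow>
     (\<forall>B. is_box B \<longrightarrow> A B [] = {}) \<and>
     (\<forall>B xs x. admissible U B (xs @ [x]) \<longrightarrow>
        A B (xs @ [x]) = A B xs \<or>
        (\<exists>y\<in>set xs. y \<notin> Field (A B xs) \<and> A B (xs @ [x]) = insert (y, x) (A B xs))) \<and>
     (\<forall>B xs. admissible U B xs \<longrightarrow> non_crossing (A B xs))"

definition profit :: "matching \<Rightarrow> real" where
  "profit M = (\<Sum>x\<in>Field M. weight x)"

definition opt :: "item list \<Rightarrow> real" where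
  "opt xs = (\<Sum>x\<leftarrow>xs. weight x)"

definition competitive :: "real \<Rightarrow> algorithm \<Rightarrow> real \<Rightarrow> bool" where
  "competitive U A \<rho> \<longleftrightarrow>
     (\<exists>c. \<forall>B xs. input U B xs \<longrightarrow> profit (A B xs) \<ge> \<rho> * opt xs - c)"

definition competitive_ratio :: "real \<Rightarrow> algorithm \<Rightarrow> real" where
  "competitive_ratio U A = Sup {\<rho>. competitive U A \<rho>}"


section \<open>Wait-and-Match\<close>

definition top_type :: "real \<Rightarrow> nat" where
  "top_type U = nat \<lceil>sqrt (log 2 U)\<rceil>"

definition threshold :: "real \<Rightarrow> nat \<Rightarrow> real" where
  "threshold U i = (U powr (1 / real (top_type U))) ^ i"

definition type_of :: "real \<Rightarrow> item \<Rightarrow> nat" where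
  "type_of U x = Max {j. j \<le> top_type U \<and> threshold U j \<le> weight x}"

text \<open>Twice the signed area of the triangle \<open>p q z\<close>: its sign tells the side of the line
  \<open>pq\<close> on which \<open>z\<close> lies.\<close>

definition orient :: "point \<Rightarrow> point \<Rightarrow> point \<Rightarrow> real" where
  "orient p q z = (q$1 - p$1) * (z$2 - p$2) - (q$2 - p$2) * (z$1 - p$1)"

definition left_side :: "point \<Rightarrow> point \<Rightarrow> point set" where
  "left_side p q = {z. orient p q z > 0}"

definition right_side :: "point \<Rightarrow> point \<Rightarrow> point set" where
  "right_side p q = {z. orient p q z < 0}"

text \<open>\<open>W\<close> is the set of unmatched points in the region of the arriving point \<open>x\<close>.\<close>

definition wam_acceptable :: "real \<Rightarrow> item set \<Rightarrow> item \<Rightarrow> item \<Rightarrow> bool" where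
  "wam_acceptable U W x y \<longleftrightarrow>
     (let i = max (type_of U x) (type_of U y); m = 2 ^ (top_type U - i) - 1 in
        card {z\<in>W. pos z \<in> left_side (pos x) (pos y)} \<ge> m \<and>
        card {z\<in>W. pos z \<in> right_side (pos x) (pos y)} \<ge> m)"

text \<open>The order in which Wait-and-Match considers candidates is determined only up to ties between
  equal weights. A tie-breaking rule is therefore a parameter: given everything known to the
  algorithm (\<open>U\<close>, the box, the points revealed so far, latest first) it lists a set of
  candidates in some non-increasing order of weight.\<close>

type_synonym consideration_order = "real \<Rightarrow> point set \<Rightarrow> item list \<Rightarrow> item set \<Rightarrow> item list"

definition by_weight :: "consideration_order \<Rightarrow> bool" where
  "by_weight ord \<longleftrightarrow>
     (\<forall>U B h W. finite W \<longrightarrow>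
        distinct (ord U B h W) \<and> set (ord U B h W) = W \<and>
        sorted_wrt (\<lambda>y z. weight y \<ge> weight z) (ord U B h W))"

text \<open>The state consists of the current regions and the current matching. Splitting a region
  drops the dividing chord, on which no further input point can lie by general position.\<close>

definition wam_step ::
  "consideration_order \<Rightarrow> real \<Rightarrow> point set \<Rightarrow> item list \<Rightarrow> item \<Rightarrow>
   point set set \<times> matching \<Rightarrow> point set set \<times> matching" where
  "wam_step ord U B past x = (\<lambda>(\<R>, M).
     let R = (THE R. R \<in> \<R> \<and> pos x \<in> R);
         W = {y \<in> set past. y \<notin> Field M \<and> pos y \<in> R}
     in case find (wam_acceptable U W x) (ord U B (x # past) W) of
          None \<Rightarrow> (\<R>, M)
        | Some y \<Rightarrow>
            ((\<R> - {R}) \<union> {R \<inter> left_side (pos x) (pos y), R \<inter> right_side (pos x) (pos y)},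
             insert (y, x) M))"

text \<open>The list argument of \<open>wam_run\<close> has the latest point first.\<close>

fun wam_run ::
  "consideration_order \<Rightarrow> real \<Rightarrow> point set \<Rightarrow> item list \<Rightarrow> point set set \<times> matching" where
  "wam_run ord U B [] = ({B}, {})"
| "wam_run ord U B (x # past) = wam_step ord U B past x (wam_run ord U B past)"

definition wam :: "consideration_order \<Rightarrow> real \<Rightarrow> algorithm" where
  "wam ord U B xs = snd (wam_run ord U B (rev xs))"

end

theory Submission
  imports Defs
begin

text \<open>Through an arriving point there is always a line to a waiting point of the region that halves
  the other waiting points. Hence a point of type \<open>j\<close> stays unmatched only if its region has fewer
  than \<open>2 ^ (k - j + 1) - 1\<close> waiting points, which bounds the weight that a region with \<open>n\<close> waiting
  points can still lose by a decreasing function of \<open>n\<close>, its capacity. A match of type \<open>i\<close> leaves at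
  least \<open>2 ^ (k - i) - 1\<close> waiting points on either side, so the capacities of the two new regions are
  \<open>O(2 ^ k * r * r ^ i)\<close> and can be charged to the matched pair, which weighs at least \<open>r ^ i\<close>. The
  unmatched weight plus the capacities of all regions is therefore at most a constant plus
  \<open>O(2 ^ k * r)\<close> times the profit.\<close>

section \<open>Orientation\<close>

text \<open>Both conditions say that \<open>q - p\<close> and \<open>z - p\<close> are parallel.
  This turns \<open>general_position\<close>, phrased with \<open>collinear\<close>, into
  information about signs.\<close>

lemma orient_eq_0_iff: "orient p q z = 0 \<longleftrightarrow> collinear {p, q, z}"
proof
  assume o: "orient p q z = 0"
  show "collinear {p, q, z}"
  proof (cases "p = q")
    case False
    then have "q$1 - p$1 \<noteq> 0 \<or> q$2 - p$2 \<noteq> 0"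
      by (auto simp: vec_eq_iff forall_2)
    then have "\<exists>c. z$1 - p$1 = c * (q$1 - p$1) \<and> z$2 - p$2 = c * (q$2 - p$2)"
    proof
      assume ne: "q$1 - p$1 \<noteq> 0"
      have "(z$2 - p$2) * (q$1 - p$1) = (z$1 - p$1) * (q$2 - p$2)"
        using o by (simp add: orient_def mult.commute)
      then have "z$2 - p$2 = (z$1 - p$1) * (q$2 - p$2) / (q$1 - p$1)"
        using ne nonzero_eq_divide_eq by blast
      then show ?thesis
        using ne by (intro exI[of _ "(z$1 - p$1) / (q$1 - p$1)"]) simp
    next
      assume ne: "q$2 - p$2 \<noteq> 0"
      have "(z$1 - p$1) * (q$2 - p$2) = (z$2 - p$2) * (q$1 - p$1)"
        using o by (simp add: orient_def mult.commute)
      then have "z$1 - p$1 = (z$2 - p$2) * (q$1 - p$1) / (q$2 - p$2)"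
        using ne nonzero_eq_divide_eq by blast
      then show ?thesis
        using ne by (intro exI[of _ "(z$2 - p$2) / (q$2 - p$2)"]) simp
    qed
    then have "\<exists>c. z - p = c *\<^sub>R (q - p)"
      by (simp add: vec_eq_iff forall_2)
    then have "collinear {0, q - p, z - p}"
      unfolding collinear_lemma by blast
    then show ?thesis
      using collinear_3[of q p z] by (simp add: insert_commute)
  qed simp
next
  assume "collinear {p, q, z}"
  then have "collinear {0, q - p, z - p}"
    using collinear_3[of q p z] by (simp add: insert_commute)
  then consider "q = p" | "z = p" | c where "z - p = c *\<^sub>R (q - p)"
    unfolding collinear_lemma by auto
  then show "orient p q z = 0"
  proof cases
    case 3
    then have "z$1 - p$1 = c * (q$1 - p$1)" "z$2 - p$2 = c * (q$2 - p$2)"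
      by (metis vector_minus_component vector_scaleR_component real_scaleR_def)+
    then show ?thesis by (simp add: orient_def)
  qed (simp_all add: orient_def)
qed

lemma orient_swap: "orient q p z = - orient p q z"
  by (simp add: orient_def algebra_simps)

lemma orient_same: "orient p q p = 0" "orient p q q = 0"
  by (simp_all add: orient_def)

text \<open>\<open>orient p q\<close> is affine in its third argument; convexity of the sides and
  vanishing on the segment both follow from this.\<close>

lemma orient_convex_comb:
  assumes "u + v = 1"
  shows "orient p q (u *\<^sub>R a + v *\<^sub>R b) = u * orient p q a + v * orient p q b"
proof -
  have v: "v = 1 - u" using assms by simp
  show ?thesis unfolding v by (simp add: orient_def) algebra
qed

lemma convex_left_side: "convex (left_side p q)"
  unfolding convex_def left_side_def
proof clarsimp
  fix a b u v
  assume "0 < orient p q a" "0 < orient p q b" "0 \<le> u" "0 \<le> v" "u + v = (1::real)"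
  then show "0 < orient p q (u *\<^sub>R a + v *\<^sub>R b)"
    by (cases "u = 0") (auto simp: orient_convex_comb intro!: add_pos_nonneg)
qed

lemma right_side_swap: "right_side p q = left_side q p"
  by (auto simp: left_side_def right_side_def orient_swap[of q p])

lemma convex_right_side: "convex (right_side p q)"
  by (simp add: right_side_swap convex_left_side)

lemma sides_disjoint: "left_side p q \<inter> right_side p q = {}"
  by (auto simp: left_side_def right_side_def)

lemma closed_segment_orient:
  assumes "z \<in> closed_segment p q"
  shows "orient p q z = 0"
proof -
  obtain u where "z = (1 - u) *\<^sub>R p + u *\<^sub>R q"
    using assms by (auto simp: closed_segment_def)
  then show ?thesis by (simp add: orient_convex_comb orient_same)
qed

lemma general_position_orient:
  assumes "general_position P" "a \<in> P" "b \<in> P" "c \<in> P" "a \<noteq> b" "a \<noteq> c" "b \<noteq> c"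
  shows "orient a b c \<noteq> 0"
  using assms by (auto simp: general_position_def orient_eq_0_iff)


section \<open>Halving lines through an arriving point\<close>

lemma finite_max_obtain:
  fixes \<kappa> :: "'a \<Rightarrow> real"
  assumes "finite W" "W \<noteq> {}"
  obtains l where "l \<in> W" "\<And>z. z \<in> W \<Longrightarrow> \<kappa> z \<le> \<kappa> l"
proof -
  have "Max (\<kappa> ` W) \<in> \<kappa> ` W" using assms by (intro Max_in) auto
  then show thesis using assms that by (metis (no_types, lifting) Max_ge finite_imageI imageE imageI)
qed

lemma finite_min_obtain:
  fixes \<kappa> :: "'a \<Rightarrow> real"
  assumes "finite W" "W \<noteq> {}"
  obtains l where "l \<in> W" "\<And>z. z \<in> W \<Longrightarrow> \<kappa> l \<le> \<kappa> z"
proof -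
  have "Min (\<kappa> ` W) \<in> \<kappa> ` W" using assms by (intro Min_in) auto
  then show thesis using assms that by (metis (no_types, lifting) Min_le finite_imageI imageE imageI)
qed

text \<open>A discrete intermediate value argument: the first \<open>a\<close> in the order of
  \<open>\<kappa>\<close> whose prefix sum reaches half of the total works, since a single sign
  moves the sum only by 1.\<close>

lemma balanced_element_pos:
  fixes \<kappa> :: "'a \<Rightarrow> real" and e :: "'a \<Rightarrow> real"
  assumes fin: "finite W" and inj: "inj_on \<kappa> W"
    and e: "\<And>z. z \<in> W \<Longrightarrow> e z = 1 \<or> e z = -1" and pos: "sum e W > 0"
  shows "\<exists>a\<in>W. \<bar>(\<Sum>z\<in>{z\<in>W. \<kappa> z < \<kappa> a}. e z) - (\<Sum>z\<in>{z\<in>W. \<kappa> a < \<kappa> z}. e z)\<bar> \<le> 1"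
proof -
  define P where "P a = (\<Sum>z\<in>{z\<in>W. \<kappa> z \<le> \<kappa> a}. e z)" for a
  define T where "T = sum e W"
  define A where "A = {a\<in>W. T \<le> 2 * P a}"
  have ne: "W \<noteq> {}" using pos by auto
  obtain l where l: "l \<in> W" "\<And>z. z \<in> W \<Longrightarrow> \<kappa> z \<le> \<kappa> l"
    using finite_max_obtain[OF fin ne, of \<kappa>] by blast
  have "{z\<in>W. \<kappa> z \<le> \<kappa> l} = W" using l by auto
  then have "l \<in> A" using l pos by (simp add: A_def P_def T_def)
  moreover have finA: "finite A" using fin by (simp add: A_def)
  ultimately obtain a where a: "a \<in> A" "\<And>z. z \<in> A \<Longrightarrow> \<kappa> a \<le> \<kappa> z"
    using finite_min_obtain[OF finA, of \<kappa>] by blast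
  have aW: "a \<in> W" using a by (simp add: A_def)
  let ?L = "{z\<in>W. \<kappa> z < \<kappa> a}" and ?G = "{z\<in>W. \<kappa> a < \<kappa> z}"
  have le: "{z\<in>W. \<kappa> z \<le> \<kappa> a} = insert a ?L"
    using aW inj by (auto simp: inj_on_def order_le_less)
  have Pa: "P a = e a + sum e ?L"
    unfolding P_def le using fin by (subst sum.insert) auto
  have "W = {z\<in>W. \<kappa> z \<le> \<kappa> a} \<union> ?G" by auto
  then have "T = P a + sum e ?G"
    unfolding T_def P_def using fin
    by (metis (no_types, lifting) sum.union_disjoint[of "{z\<in>W. \<kappa> z \<le> \<kappa> a}" ?G e] finite_Un
        disjoint_iff mem_Collect_eq not_le)
  \<comment> \<open>The predecessor \<open>b\<close> of \<open>a\<close> is outside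
    \<open>A\<close>, so its prefix sum is below half. Without a predecessor the sum is 0, which is
    below half because the total is positive.\<close>
  moreover have "2 * sum e ?L < T"
  proof (cases "?L = {}")
    case True
    then show ?thesis using pos unfolding True by (simp add: T_def)
  next
    case False
    then obtain b where b: "b \<in> ?L" "\<And>z. z \<in> ?L \<Longrightarrow> \<kappa> z \<le> \<kappa> b"
      using finite_max_obtain[of ?L \<kappa>] fin by auto
    have "{z\<in>W. \<kappa> z \<le> \<kappa> b} = ?L" using b by fastforce
    then have "P b = sum e ?L" by (simp add: P_def)
    moreover have "b \<notin> A" using a(2)[of b] b by auto
    ultimately show ?thesis using b by (simp add: A_def)
  qed
  moreover have "T \<le> 2 * P a" using a by (simp add: A_def)
  ultimately show ?thesis
    using Pa e[OF aW] by (intro bexI[OF _ aW]) (auto simp: abs_le_iff)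
qed

text \<open>Negating \<open>e\<close> reduces a negative total to a positive one; only the total
  zero needs its own choice.\<close>

lemma balanced_element:
  fixes \<kappa> :: "'a \<Rightarrow> real" and e :: "'a \<Rightarrow> real"
  assumes fin: "finite W" and ne: "W \<noteq> {}" and inj: "inj_on \<kappa> W"
    and e: "\<And>z. z \<in> W \<Longrightarrow> e z = 1 \<or> e z = -1"
  shows "\<exists>a\<in>W. \<bar>(\<Sum>z\<in>{z\<in>W. \<kappa> z < \<kappa> a}. e z) - (\<Sum>z\<in>{z\<in>W. \<kappa> a < \<kappa> z}. e z)\<bar> \<le> 1"
proof -
  consider "sum e W > 0" | "sum e W < 0" | "sum e W = 0" by linarith
  then show ?thesis
  proof cases
    case 1
    then show ?thesis using balanced_element_pos[OF fin inj, of e] e by blast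
  next
    case 2
    then have "\<exists>a\<in>W. \<bar>(\<Sum>z\<in>{z\<in>W. \<kappa> z < \<kappa> a}. - e z) - (\<Sum>z\<in>{z\<in>W. \<kappa> a < \<kappa> z}. - e z)\<bar> \<le> 1"
      using e by (intro balanced_element_pos[OF fin inj]) (fastforce simp: sum_negf)+
    then show ?thesis by (simp add: sum_negf abs_minus_commute)
  next
    \<comment> \<open>For the \<open>\<kappa>\<close>-least \<open>a\<close> the first sum is empty
      and the second is \<open>- e a\<close>, because the total is zero.\<close>
    case 3
    obtain a where a: "a \<in> W" "\<And>z. z \<in> W \<Longrightarrow> \<kappa> a \<le> \<kappa> z"
      using finite_min_obtain[OF fin ne, of \<kappa>] by blast
    have emp: "{z\<in>W. \<kappa> z < \<kappa> a} = {}" using a by fastforce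
    have rest: "{z\<in>W. \<kappa> a < \<kappa> z} = W - {a}"
      using a inj by (auto simp: inj_on_def order_le_less)
    have "\<bar>sum e {} - sum e (W - {a})\<bar> \<le> 1"
      using 3 e[OF a(1)] a(1) fin by (auto simp: sum_diff1)
    then show ?thesis
      using a(1) emp rest by metis
  qed
qed

section \<open>Halving lines in the plane\<close>

lemma avoid_vertical:
  assumes "finite V"
  shows "\<exists>s::real. \<forall>v\<in>V. v \<noteq> (0 :: real^2) \<longrightarrow> v$2 + s * v$1 \<noteq> 0"
proof -
  \<comment> \<open>A vector with nonzero first coordinate excludes the single value
    \<open>- v$2 / v$1\<close>; a nonzero vector with first coordinate 0 excludes none.\<close>
  obtain s where s: "s \<notin> (\<lambda>v. - v$2 / v$1) ` V"
    using assms ex_new_if_finite[OF infinite_UNIV_char_0] by blast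
  show ?thesis
  proof (intro exI[of _ s] ballI impI notI)
    fix v assume "v \<in> V" "v \<noteq> 0" "v$2 + s * v$1 = 0"
    then show False
      using s by (cases "v$1 = 0") (auto simp: vec_eq_iff forall_2 image_iff field_simps)
  qed
qed

text \<open>When a line turns about \<open>p\<close> through the points of \<open>W\<close> in slope
  order, the imbalance of its sides is a difference of sums of signs, so
  \<open>balanced_element\<close> supplies a line whose sides differ by at most 1. They share
  \<open>card W - 1 \<ge> 2 * m\<close> points, so each gets at least \<open>m\<close>.\<close>

lemma halving_line:
  fixes f :: "'a \<Rightarrow> point"
  assumes fin: "finite W" and ne: "W \<noteq> {}"
    and gp: "\<And>y z. y \<in> W \<Longrightarrow> z \<in> W \<Longrightarrow> y \<noteq> z \<Longrightarrow> orient p (f y) (f z) \<noteq> 0"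
    and np: "\<And>y. y \<in> W \<Longrightarrow> f y \<noteq> p"
    and m: "2 * m + 1 \<le> card W"
  shows "\<exists>y\<in>W. m \<le> card {z\<in>W. f z \<in> left_side p (f y)} \<and>
    m \<le> card {z\<in>W. f z \<in> right_side p (f y)}"
proof -
  obtain s where s: "\<forall>v\<in>(\<lambda>y. f y - p) ` W. v \<noteq> 0 \<longrightarrow> v$2 + s * v$1 \<noteq> 0"
    using avoid_vertical[of "(\<lambda>y. f y - p) ` W"] fin by blast
  \<comment> \<open>After the shear no point of \<open>W\<close> has vertical coordinate
    \<open>b\<close> equal to 0. So \<open>\<kappa>\<close> is a genuine reciprocal slope, and
    \<open>e\<close> tells whether the point is above or below \<open>p\<close>.\<close>
  define a where "a y = (f y - p) $ 1" for y
  define b where "b y = (f y - p) $ 2 + s * a y" for y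
  define \<kappa> where "\<kappa> y = a y / b y" for y
  define e where "e y = sgn (b y)" for y
  have b0: "b y \<noteq> 0" if "y \<in> W" for y
    using s np that by (force simp: b_def a_def)
  \<comment> \<open>the shear with parameter \<open>s\<close> preserves cross products\<close>
  have or: "orient p (f y) (f z) = b y * b z * (\<kappa> y - \<kappa> z)" if "y \<in> W" "z \<in> W" for y z
  proof -
    have "orient p (f y) (f z) = a y * b z - b y * a z"
      by (simp add: orient_def a_def b_def algebra_simps)
    also have "\<dots> = b y * b z * (\<kappa> y - \<kappa> z)"
      using b0 that by (simp add: \<kappa>_def field_simps)
    finally show ?thesis .
  qed
  have inj: "inj_on \<kappa> W"
    using gp or by (force simp: inj_on_def)
  have e1: "e y = 1 \<or> e y = -1" if "y \<in> W" for y
    using b0[OF that] by (auto simp: e_def sgn_if)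
  obtain y where y: "y \<in> W"
    and bal: "\<bar>(\<Sum>z\<in>{z\<in>W. \<kappa> z < \<kappa> y}. e z) - (\<Sum>z\<in>{z\<in>W. \<kappa> y < \<kappa> z}. e z)\<bar> \<le> 1"
    using balanced_element[OF fin ne inj, of e] e1 by blast
  let ?L = "{z\<in>W. f z \<in> left_side p (f y)}" and ?R = "{z\<in>W. f z \<in> right_side p (f y)}"
  have sg: "sgn (orient p (f y) (f z)) = e y * (e z * sgn (\<kappa> y - \<kappa> z))" if "z \<in> W" for z
    by (simp add: or y that sgn_mult e_def)
  \<comment> \<open>The point \<open>y\<close> itself lies on the line and contributes sign
    0.\<close>
  have "real (card ?L) - real (card ?R) = (\<Sum>z\<in>W. sgn (orient p (f y) (f z)))"
  proof -
    have "(\<Sum>z\<in>W. sgn (orient p (f y) (f z))) =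
      (\<Sum>z\<in>W. of_bool (f z \<in> left_side p (f y)) - of_bool (f z \<in> right_side p (f y)))"
      by (intro sum.cong) (auto simp: left_side_def right_side_def sgn_if)
    also have "\<dots> = real (card ?L) - real (card ?R)"
      using fin by (simp add: sum_subtractf Int_def)
    finally show ?thesis by simp
  qed
  also have "\<dots> = e y * (\<Sum>z\<in>W. e z * sgn (\<kappa> y - \<kappa> z))"
    by (simp add: sg sum_distrib_left)
  also have "(\<Sum>z\<in>W. e z * sgn (\<kappa> y - \<kappa> z)) =
    (\<Sum>z\<in>W. (if \<kappa> z < \<kappa> y then e z else 0) - (if \<kappa> y < \<kappa> z then e z else 0))"
    by (intro sum.cong) (auto simp: sgn_if)
  also have "\<dots> = (\<Sum>z\<in>{z\<in>W. \<kappa> z < \<kappa> y}. e z) - (\<Sum>z\<in>{z\<in>W. \<kappa> y < \<kappa> z}. e z)"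
    using fin by (simp add: sum_subtractf sum.If_cases Int_def)
  finally have "\<bar>real (card ?L) - real (card ?R)\<bar> \<le> 1"
    using bal e1[OF y] by (auto simp: abs_mult)
  moreover have "card ?L + card ?R = card (W - {y})"
  proof -
    have "W - {y} = ?L \<union> ?R"
    proof (intro set_eqI iffI)
      fix z assume z: "z \<in> W - {y}"
      then have "orient p (f y) (f z) \<noteq> 0" using gp[OF y] by auto
      with z show "z \<in> ?L \<union> ?R"
        by (simp add: left_side_def right_side_def) linarith
    qed (auto simp: left_side_def right_side_def orient_same)
    moreover have "?L \<inter> ?R = {}" using sides_disjoint by blast
    ultimately show ?thesis using fin by (simp add: card_Un_disjoint)
  qed
  moreover have "card (W - {y}) = card W - 1" using y fin by simp
  ultimately have "m \<le> card ?L" "m \<le> card ?R" using m by linarith+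
  then show ?thesis using y by blast
qed


section \<open>Regions and chords\<close>

definition waiting :: "item list \<Rightarrow> matching \<Rightarrow> point set \<Rightarrow> item set" where
  "waiting past M R = {y \<in> set past. y \<notin> Field M \<and> pos y \<in> R}"

lemma finite_waiting [simp]: "finite (waiting past M R)"
  by (simp add: waiting_def)

text \<open>The regions cover only those points of \<open>B\<close> that lie on none of the lines through matched pairs,
  since dividing chords are dropped.\<close>

definition geo_inv :: "point set \<Rightarrow> item list \<Rightarrow> point set set \<Rightarrow> matching \<Rightarrow> bool" where
  "geo_inv B past \<R> M \<longleftrightarrow>
     Field M \<subseteq> set past \<and> finite \<R> \<and> (\<forall>R\<in>\<R>. convex R) \<and> disjoint \<R> \<and>
     (\<forall>z\<in>B. (\<forall>(a, b)\<in>M. orient (pos a) (pos b) z \<noteq> 0) \<longrightarrow> z \<in> \<Union>\<R>) \<and>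
     (\<forall>(a, b)\<in>M. a \<noteq> b \<and> (\<forall>R\<in>\<R>. closed_segment (pos a) (pos b) \<inter> R = {})) \<and>
     non_crossing M"

section \<open>Admissible sequences and the outcome of one arrival\<close>

lemma admissible_rev: "admissible U B (rev xs) = admissible U B xs"
  by (simp add: admissible_def rev_map[symmetric])

lemma admissible_Cons: "admissible U B (x # past) \<Longrightarrow> admissible U B past"
  by (auto simp: admissible_def general_position_def)

lemma admissible_pos_inj:
  assumes "admissible U B xs" "a \<in> set xs" "b \<in> set xs" "pos a = pos b"
  shows "a = b"
  using assms by (auto simp: admissible_def distinct_map inj_on_def)

lemma admissible_orient:
  assumes "admissible U B xs" "a \<in> set xs" "b \<in> set xs" "c \<in> set xs" "a \<noteq> b" "a \<noteq> c" "b \<noteq> c"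
  shows "orient (pos a) (pos b) (pos c) \<noteq> 0"
proof (rule general_position_orient)
  show "general_position (pos ` set xs)" using assms by (simp add: admissible_def)
  show "pos a \<noteq> pos b" "pos a \<noteq> pos c" "pos b \<noteq> pos c"
    using assms admissible_pos_inj[OF assms(1)] by metis+
qed (use assms in auto)

lemma admissible_fresh:
  assumes "admissible U B (x # past)" shows "x \<notin> set past"
  using assms by (auto simp: admissible_def)

text \<open>General position keeps \<open>pos x\<close> off every line through a matched pair, so
  the covering clause of \<open>geo_inv\<close> gives a region, and disjointness makes it unique;
  this resolves the \<open>THE\<close> in \<open>wam_step\<close>. As \<open>ord\<close> lists
  exactly the waiting points, a failing \<open>find\<close> rejects all of them.\<close>

lemma wam_step_cases:
  assumes bw: "by_weight ord" and adm: "admissible U B (x # past)" and inv: "geo_inv B past \<R> M"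
  obtains (unmatched) R where "R \<in> \<R>" "pos x \<in> R"
      "\<And>y. y \<in> waiting past M R \<Longrightarrow> \<not> wam_acceptable U (waiting past M R) x y"
      "wam_step ord U B past x (\<R>, M) = (\<R>, M)"
    | (matched) R y where "R \<in> \<R>" "pos x \<in> R" "y \<in> waiting past M R"
      "wam_acceptable U (waiting past M R) x y"
      "wam_step ord U B past x (\<R>, M) =
        ((\<R> - {R}) \<union> {R \<inter> left_side (pos x) (pos y), R \<inter> right_side (pos x) (pos y)},
         insert (y, x) M)"
proof -
  have "orient (pos a) (pos b) (pos x) \<noteq> 0" if "(a, b) \<in> M" for a b
  proof -
    have ab: "a \<in> set past" "b \<in> set past" "a \<noteq> b"
      using inv that by (auto simp: geo_inv_def dest: FieldI1 FieldI2)
    then show ?thesis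
      using admissible_fresh[OF adm] by (intro admissible_orient[OF adm]) auto
  qed
  moreover have "pos x \<in> B" using adm by (simp add: admissible_def)
  ultimately have "pos x \<in> \<Union>\<R>"
    using inv unfolding geo_inv_def by blast
  then obtain R where R: "R \<in> \<R>" "pos x \<in> R" by blast
  have the: "(THE R. R \<in> \<R> \<and> pos x \<in> R) = R"
    using inv R unfolding geo_inv_def disjoint_def by (intro the_equality) blast+
  let ?W = "waiting past M R"
  have set: "set (ord U B (x # past) ?W) = ?W"
    using bw by (simp add: by_weight_def)
  have step: "wam_step ord U B past x (\<R>, M) =
     (case find (wam_acceptable U ?W x) (ord U B (x # past) ?W) of
          None \<Rightarrow> (\<R>, M)
        | Some y \<Rightarrow>
            ((\<R> - {R}) \<union> {R \<inter> left_side (pos x) (pos y), R \<inter> right_side (pos x) (pos y)},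
             insert (y, x) M))"
    unfolding wam_step_def prod.case Let_def the waiting_def by simp
  show thesis
  proof (cases "find (wam_acceptable U ?W x) (ord U B (x # past) ?W)")
    case None
    show thesis
    proof (rule unmatched[OF R])
      show "\<not> wam_acceptable U ?W x y" if "y \<in> ?W" for y
        using None set that find_None_iff by metis
      show "wam_step ord U B past x (\<R>, M) = (\<R>, M)"
        by (simp only: step None option.case)
    qed
  next
    case (Some y)
    then have "wam_acceptable U ?W x y" "y \<in> ?W"
      using set by (metis find_Some_iff nth_mem)+
    then show thesis using matched[OF R] step Some by simp
  qed
qed

section \<open>Preservation of the region invariant\<close>

lemma geo_inv_Nil: "is_box B \<Longrightarrow> geo_inv B [] {B} {}"
  by (auto simp: geo_inv_def is_box_def non_crossing_def)

lemma geo_inv_unmatched: "geo_inv B past \<R> M \<Longrightarrow> geo_inv B (x # past) \<R> M"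
  by (auto simp: geo_inv_def)

text \<open>The new segment stays inside the convex region \<open>R\<close>, which the old segments
  avoid, so it meets none of them. It lies on the dividing line, so it avoids both open halves of
  \<open>R\<close>.\<close>

lemma geo_inv_matched:
  assumes adm: "admissible U B (x # past)" and inv: "geo_inv B past \<R> M"
    and R: "R \<in> \<R>" "pos x \<in> R" and y: "y \<in> waiting past M R"
  shows "geo_inv B (x # past)
    ((\<R> - {R}) \<union> {R \<inter> left_side (pos x) (pos y), R \<inter> right_side (pos x) (pos y)})
    (insert (y, x) M)" (is "geo_inv _ _ ?\<R> ?M")
proof -
  let ?S = "closed_segment (pos y) (pos x)"
  have yp: "y \<in> set past" "pos y \<in> R" using y by (auto simp: waiting_def)
  have xy: "y \<noteq> x" using yp admissible_fresh[OF adm] by auto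
  have sub: "\<exists>R\<in>\<R>. R' \<subseteq> R" if "R' \<in> ?\<R>" for R' using that R by auto
  have cv: "\<forall>R\<in>\<R>. convex R" and dj: "disjoint \<R>" and nc: "non_crossing M"
    and fM: "Field M \<subseteq> set past" and fin: "finite \<R>"
    and cover: "\<And>z. z \<in> B \<Longrightarrow> \<forall>(a, b)\<in>M. orient (pos a) (pos b) z \<noteq> 0 \<Longrightarrow> z \<in> \<Union>\<R>"
    and seg: "\<And>a b. (a, b) \<in> M \<Longrightarrow> a \<noteq> b \<and> (\<forall>R\<in>\<R>. closed_segment (pos a) (pos b) \<inter> R = {})"
    using inv unfolding geo_inv_def by blast+
  have SR: "?S \<subseteq> R" using cv R yp by (intro closed_segment_subset) auto
  have SM: "closed_segment (pos a) (pos b) \<inter> ?S = {}" if "(a, b) \<in> M" for a b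
    using seg[OF that] R SR by blast
  have S_sides: "?S \<inter> left_side (pos x) (pos y) = {}" "?S \<inter> right_side (pos x) (pos y) = {}"
    using closed_segment_orient[of _ "pos y" "pos x"]
    by (fastforce simp: left_side_def right_side_def orient_swap[of "pos x"])+
  have field: "Field ?M \<subseteq> set (x # past)" using fM yp by auto
  have finite: "finite ?\<R>" using fin by simp
  have convex: "\<forall>R\<in>?\<R>. convex R"
    using cv R by (auto intro!: convex_Int convex_left_side convex_right_side)
  have disjoint: "disjoint ?\<R>"
  proof -
    have "R' \<inter> R'' = {}" if "R' \<in> \<R> - {R}" "R'' \<subseteq> R" for R' R''
      using that dj R by (auto simp: disjoint_def)
    note old_new = this
    show ?thesis
      unfolding disjoint_def
    proof (intro ballI impI)
      fix P Q assume PQ: "P \<in> ?\<R>" "Q \<in> ?\<R>" "P \<noteq> Q"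
      \<comment> \<open>The last case is that of two distinct, hence opposite, halves of
        \<open>R\<close>.\<close>
      then consider "P \<in> \<R> - {R}" "Q \<in> \<R> - {R}" | "P \<in> \<R> - {R}" "Q \<subseteq> R"
        | "P \<subseteq> R" "Q \<in> \<R> - {R}"
        | "P \<inter> Q \<subseteq> left_side (pos x) (pos y) \<inter> right_side (pos x) (pos y)"
        by fast
      then show "P \<inter> Q = {}"
      proof cases
        case 1
        then show ?thesis using dj PQ(3) unfolding disjoint_def by blast
      next
        case 2
        then show ?thesis by (rule old_new)
      next
        case 3
        then show ?thesis using old_new[of Q P] by blast
      next
        case 4
        then show ?thesis using sides_disjoint by blast
      qed
    qed
  qed
  have covered: "z \<in> \<Union>?\<R>" if z: "z \<in> B" "\<forall>(a, b)\<in>?M. orient (pos a) (pos b) z \<noteq> 0" for z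
  proof -
    have "\<forall>(a, b)\<in>M. orient (pos a) (pos b) z \<noteq> 0"
      using z(2) by simp
    then obtain R' where R': "R' \<in> \<R>" "z \<in> R'" using cover[OF z(1)] by blast
    have "orient (pos y) (pos x) z \<noteq> 0" using z(2) by simp
    then have "z \<in> left_side (pos x) (pos y) \<or> z \<in> right_side (pos x) (pos y)"
      using orient_swap[of "pos x" "pos y" z] by (simp add: left_side_def right_side_def) linarith
    \<comment> \<open>A region other than \<open>R\<close> survives; a point of \<open>R\<close> off
      the new line falls into one of the halves.\<close>
    then show ?thesis using R' by (cases "R' = R") auto
  qed
  have avoid: "a \<noteq> b \<and> (\<forall>R\<in>?\<R>. closed_segment (pos a) (pos b) \<inter> R = {})"
    if "(a, b) \<in> ?M" for a b
  proof (cases "(a, b) \<in> M")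
    case True
    have "closed_segment (pos a) (pos b) \<inter> R' = {}" if R': "R' \<in> ?\<R>" for R'
    proof -
      obtain R0 where "R0 \<in> \<R>" "R' \<subseteq> R0" using sub[OF R'] by (rule bexE)
      then show ?thesis using seg[OF True] by fast
    qed
    then show ?thesis using seg[OF True] by simp
  next
    case False
    then have ab: "a = y" "b = x" using that by auto
    have "?S \<inter> R' = {}" if "R' \<in> \<R> - {R}" for R'
      using that SR dj R by (auto simp: disjoint_def)
    then have "?S \<inter> R' = {}" if "R' \<in> ?\<R>" for R'
      using that S_sides by (cases "R' \<in> \<R> - {R}") (simp, fast)
    then show ?thesis unfolding ab using xy by simp
  qed
  have crossing: "non_crossing ?M"
    using nc SM unfolding non_crossing_def pairwise_insert by (auto simp: Int_commute)
  show ?thesis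
    unfolding geo_inv_def
  proof (intro conjI field finite convex disjoint crossing ballI impI)
    fix z assume "z \<in> B" "\<forall>(a, b)\<in>?M. orient (pos a) (pos b) z \<noteq> 0"
    then show "z \<in> \<Union>?\<R>" by (rule covered)
  next
    fix e assume "e \<in> ?M"
    then show "case e of (a, b) \<Rightarrow> a \<noteq> b \<and> (\<forall>R\<in>?\<R>. closed_segment (pos a) (pos b) \<inter> R = {})"
      using avoid[of "fst e" "snd e"] by (simp add: case_prod_beta)
  qed
qed

lemma geo_inv_run:
  assumes bw: "by_weight ord" and adm: "admissible U B past"
  shows "geo_inv B past (fst (wam_run ord U B past)) (snd (wam_run ord U B past))"
  using adm
proof (induction past)
  case Nil
  then show ?case by (simp add: geo_inv_Nil admissible_def)
next
  case (Cons x past)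
  obtain \<R> M where st: "wam_run ord U B past = (\<R>, M)" by fastforce
  have inv: "geo_inv B past \<R> M" using Cons admissible_Cons st by fastforce
  show ?case
    using bw Cons.prems inv
  proof (cases rule: wam_step_cases)
    case (unmatched R)
    then show ?thesis using inv st by (simp add: geo_inv_unmatched)
  next
    case (matched R y)
    then show ?thesis using geo_inv_matched[OF Cons.prems inv matched(1-3)] st by simp
  qed
qed

text \<open>The case analysis of one step gives the online condition, and \<open>geo_inv\<close>
  along the run gives the absence of crossings.\<close>

lemma online_wam:
  assumes bw: "by_weight ord"
  shows "online_algorithm U (wam ord U)"
  unfolding online_algorithm_def
proof (intro conjI allI impI)
  fix B :: "point set" show "wam ord U B [] = {}" by (simp add: wam_def)
next
  fix B xs assume "admissible U B xs"
  then show "non_crossing (wam ord U B xs)"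
    using geo_inv_run[OF bw, of U B "rev xs"]
    by (simp add: admissible_rev wam_def geo_inv_def)
next
  fix B xs x assume "admissible U B (xs @ [x])"
  then have adm: "admissible U B (x # rev xs)"
    using admissible_rev[of U B "xs @ [x]"] by simp
  obtain \<R> M where st: "wam_run ord U B (rev xs) = (\<R>, M)" by fastforce
  have inv: "geo_inv B (rev xs) \<R> M"
    using geo_inv_run[OF bw admissible_Cons[OF adm]] st by simp
  show "wam ord U B (xs @ [x]) = wam ord U B xs \<or>
    (\<exists>y\<in>set xs. y \<notin> Field (wam ord U B xs) \<and>
      wam ord U B (xs @ [x]) = insert (y, x) (wam ord U B xs))"
    using bw adm inv
  proof (cases rule: wam_step_cases)
    case (unmatched R)
    then show ?thesis by (simp add: wam_def st)
  next
    case (matched R y)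
    then show ?thesis by (auto simp: wam_def st waiting_def)
  qed
qed


section \<open>The capacity of a region\<close>

lemma threshold_top:
  assumes "U \<ge> 1" shows "threshold U (top_type U) = U"
proof (cases "top_type U = 0")
  case True
  \<comment> \<open>Here the square root is at most 0, which for \<open>U \<ge> 1\<close> leaves
    only \<open>U = 1\<close>.\<close>
  then have "U = 1" using assms by (simp add: top_type_def)
  then show ?thesis by (simp add: threshold_def)
next
  case False
  then show ?thesis using assms by (simp add: threshold_def powr_power)
qed

lemma threshold_mono: "U \<ge> 1 \<Longrightarrow> i \<le> j \<Longrightarrow> threshold U i \<le> threshold U j"
  unfolding threshold_def by (intro power_increasing) (auto intro: ge_one_powr_ge_zero)

lemma threshold_nonneg: "threshold U i \<ge> 0"
  by (simp add: threshold_def)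

text \<open>The threshold of index 0 is 1, so every weight has a type. The upper bound is the
  maximality of the type; for the top type it comes from \<open>threshold_top\<close>.\<close>

lemma type_of_bounds:
  assumes U: "U \<ge> 1" and w: "weight x \<in> {1..U}"
  shows "type_of U x \<le> top_type U" "threshold U (type_of U x) \<le> weight x"
    "weight x \<le> threshold U (Suc (type_of U x))"
proof -
  let ?J = "{j. j \<le> top_type U \<and> threshold U j \<le> weight x}"
  have fin: "finite ?J" by simp
  have "0 \<in> ?J" using w by (simp add: threshold_def)
  then have in_J: "type_of U x \<in> ?J"
    unfolding type_of_def using fin by (intro Max_in) auto
  then show le: "type_of U x \<le> top_type U" "threshold U (type_of U x) \<le> weight x"
    by simp_all
  show "weight x \<le> threshold U (Suc (type_of U x))"
  proof (cases "type_of U x = top_type U")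
    case True
    then have "U \<le> threshold U (Suc (type_of U x))"
      using threshold_mono[OF U, of "top_type U" "Suc (top_type U)"] threshold_top[OF U] by simp
    then show ?thesis using w by simp
  next
    case False
    have "Suc (type_of U x) \<notin> ?J"
    proof
      assume "Suc (type_of U x) \<in> ?J"
      from Max_ge[OF fin this] show False by (simp add: type_of_def)
    qed
    then show ?thesis using le(1) False by auto
  qed
qed

text \<open>An upper bound for the total weight of the points that may still be left unmatched on arrival
  in a region with \<open>n\<close> waiting points: a point of type \<open>j\<close> is left unmatched only if
  \<open>n + 2 \<le> 2 ^ (top_type U - j + 1)\<close>. The subtraction of \<open>n\<close> is truncated on purpose.\<close>

definition capacity :: "real \<Rightarrow> nat \<Rightarrow> real" where
  "capacity U n =
     (\<Sum>j\<le>top_type U. threshold U (Suc j) * real (2 ^ Suc (top_type U - j) - 1 - n))"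

lemma capacity_nonneg: "capacity U n \<ge> 0"
  unfolding capacity_def by (intro sum_nonneg mult_nonneg_nonneg) (simp_all add: threshold_nonneg)

lemma capacity_antimono: "m \<le> n \<Longrightarrow> capacity U n \<le> capacity U m"
  unfolding capacity_def
  by (intro sum_mono mult_left_mono) (auto simp: threshold_nonneg)

text \<open>The bound on \<open>n\<close> keeps the integer factor of the \<open>j\<close>-th
  summand at least 1, so one more waiting point lowers that summand by exactly
  \<open>threshold U (Suc j)\<close>, and no other summand grows. This drop pays for a point of type
  \<open>j\<close> left unmatched.\<close>

lemma capacity_Suc:
  assumes j: "j \<le> top_type U" and n: "n + 2 \<le> 2 ^ Suc (top_type U - j)"
  shows "threshold U (Suc j) + capacity U (Suc n) \<le> capacity U n"
proof -
  define t where "t m i = threshold U (Suc i) * real (2 ^ Suc (top_type U - i) - 1 - m)" for m i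
  have split: "capacity U m = t m j + (\<Sum>i\<in>{..top_type U} - {j}. t m i)" for m
    unfolding capacity_def t_def using j by (subst sum.remove[of _ j]) auto
  have "2 ^ Suc (top_type U - j) - 1 - n = Suc (2 ^ Suc (top_type U - j) - 1 - Suc n)"
    using n by linarith
  then have "t n j = threshold U (Suc j) + t (Suc n) j"
    unfolding t_def by (simp only: of_nat_Suc) (simp add: algebra_simps)
  moreover have "(\<Sum>i\<in>{..top_type U} - {j}. t (Suc n) i) \<le> (\<Sum>i\<in>{..top_type U} - {j}. t n i)"
    unfolding t_def by (intro sum_mono mult_left_mono) (auto simp: threshold_nonneg)
  ultimately show ?thesis by (simp add: split)
qed

text \<open>Consecutive summands have ratio \<open>r / 2 \<ge> 2\<close>, so the sum is at most
  twice its last summand.\<close>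

lemma geometric_bound:
  fixes r :: real
  assumes r: "r \<ge> 4" and "i \<le> k"
  shows "(\<Sum>j\<le>i. r ^ Suc j * 2 ^ Suc (k - j)) \<le> 4 * 2 ^ (k - i) * r ^ Suc i"
  using assms(2)
proof (induction i)
  case 0
  then show ?case using r by simp
next
  case (Suc i)
  then have k: "k - i = Suc (k - Suc i)" by simp
  define c where "c = (2::real) ^ (k - Suc i)"
  have "4 * (r ^ Suc i * c) \<le> r * (r ^ Suc i * c)"
    using r by (intro mult_right_mono) (auto simp: c_def)
  moreover have "(\<Sum>j\<le>i. r ^ Suc j * 2 ^ Suc (k - j)) \<le> 8 * (r ^ Suc i * c)"
    using Suc k by (simp add: c_def mult_ac)
  ultimately show ?case
    by (simp add: c_def[symmetric] mult_ac)
qed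

text \<open>Bounds the capacity of either half after a match of type \<open>i\<close>: types above
  \<open>i\<close> contribute nothing, and the rest is a geometric sum dominated by type
  \<open>i\<close>.\<close>

lemma capacity_after_split:
  assumes r: "U powr (1 / real (top_type U)) \<ge> 4" and i: "i \<le> top_type U"
  shows "capacity U (2 ^ (top_type U - i) - 1)
    \<le> 4 * 2 ^ top_type U * U powr (1 / real (top_type U)) * threshold U i"
proof -
  define k where "k = top_type U"
  define r where "r = U powr (1 / real k)"
  have th: "threshold U j = r ^ j" for j by (simp add: threshold_def r_def k_def)
  have r4: "r \<ge> 4" using r by (simp add: r_def k_def)
  have "capacity U (2 ^ (k - i) - 1) =
      (\<Sum>j\<le>k. r ^ Suc j * real (2 ^ Suc (k - j) - 1 - (2 ^ (k - i) - 1)))"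
    by (simp only: capacity_def th k_def)
  also have "\<dots> = (\<Sum>j\<le>i. r ^ Suc j * real (2 ^ Suc (k - j) - 1 - (2 ^ (k - i) - 1)))"
  proof (intro sum.mono_neutral_right ballI)
    \<comment> \<open>Truncated subtraction makes the summands with \<open>j > i\<close>
      vanish.\<close>
    fix j assume "j \<in> {..k} - {..i}"
    then have "Suc (k - j) \<le> k - i" by auto
    then have "(2::nat) ^ Suc (k - j) \<le> 2 ^ (k - i)" by (intro power_increasing) auto
    then have "2 ^ Suc (k - j) - 1 - (2 ^ (k - i) - 1) = (0::nat)" by linarith
    then show "r ^ Suc j * real (2 ^ Suc (k - j) - 1 - (2 ^ (k - i) - 1)) = 0" by (simp only:)
  qed (use i in \<open>auto simp: k_def\<close>)
  also have "\<dots> \<le> (\<Sum>j\<le>i. r ^ Suc j * 2 ^ Suc (k - j))"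
  proof (intro sum_mono mult_left_mono)
    fix j
    have "real (2 ^ Suc (k - j) - 1 - (2 ^ (k - i) - 1)) \<le> real (2 ^ Suc (k - j))"
      by (intro of_nat_mono) linarith
    then show "real (2 ^ Suc (k - j) - 1 - (2 ^ (k - i) - 1)) \<le> 2 ^ Suc (k - j)"
      by simp
  qed (use r4 in auto)
  also have "\<dots> \<le> 4 * 2 ^ (k - i) * r ^ Suc i"
    using geometric_bound[OF r4] i by (simp add: k_def)
  \<comment> \<open>Replacing \<open>2 ^ (k - i)\<close> by \<open>2 ^ k\<close> makes the factor
    independent of \<open>i\<close>, so a single charge serves all types.\<close>
  also have "\<dots> \<le> 4 * 2 ^ k * r ^ Suc i"
    using r4 by (intro mult_right_mono mult_left_mono power_increasing) auto
  finally show ?thesis by (simp add: th k_def[symmetric] r_def[symmetric] mult_ac)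
qed

text \<open>Otherwise a halving line through \<open>x\<close> would have on each side the
  \<open>m\<close> waiting points that the type of \<open>x\<close> alone demands, and the point
  \<open>y\<close> on it would be acceptable.\<close>

lemma few_waiting_if_unmatched:
  assumes adm: "admissible U B (x # past)"
    and rej: "\<And>y. y \<in> waiting past M R \<Longrightarrow> \<not> wam_acceptable U (waiting past M R) x y"
  shows "card (waiting past M R) + 2 \<le> 2 ^ Suc (top_type U - type_of U x)"
proof (rule ccontr)
  let ?W = "waiting past M R"
  define m :: nat where "m = 2 ^ (top_type U - type_of U x) - 1"
  have m1: "Suc m = 2 ^ (top_type U - type_of U x)" by (simp add: m_def)
  assume "\<not> ?thesis"
  then have m: "2 * m + 1 \<le> card ?W" using m1 by simp
  have W: "?W \<subseteq> set past" by (auto simp: waiting_def)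
  have "\<exists>y\<in>?W. m \<le> card {z\<in>?W. pos z \<in> left_side (pos x) (pos y)} \<and>
      m \<le> card {z\<in>?W. pos z \<in> right_side (pos x) (pos y)}"
  proof (rule halving_line[OF _ _ _ _ m])
    show "?W \<noteq> {}" using m by auto
    fix y assume y: "y \<in> ?W"
    then show "pos y \<noteq> pos x"
      using admissible_pos_inj[OF adm, of y x] admissible_fresh[OF adm] W by auto
    fix z assume "z \<in> ?W" "y \<noteq> z"
    then show "orient (pos x) (pos y) (pos z) \<noteq> 0"
      using y admissible_fresh[OF adm] W by (intro admissible_orient[OF adm]) auto
  qed simp
  then obtain y where y: "y \<in> ?W" "m \<le> card {z\<in>?W. pos z \<in> left_side (pos x) (pos y)}"
      "m \<le> card {z\<in>?W. pos z \<in> right_side (pos x) (pos y)}" by blast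
  \<comment> \<open>Acceptability uses the larger of the two types, which can only lower the
    demand.\<close>
  have "2 ^ (top_type U - max (type_of U x) (type_of U y)) - 1 \<le> m"
    unfolding m_def by (intro diff_le_mono power_increasing) auto
  then have "wam_acceptable U ?W x y"
    using y by (auto simp: wam_acceptable_def Let_def)
  then show False using rej y by blast
qed


section \<open>The competitive ratio\<close>

text \<open>The factor 8 covers two new regions, each with the factor 4 of
  \<open>capacity_after_split\<close>.\<close>

definition charge :: "real \<Rightarrow> real" where
  "charge U = 8 * 2 ^ top_type U * U powr (1 / real (top_type U))"

text \<open>\<open>capacity U 0\<close> is the capacity of the initial region \<open>B\<close>
  before any arrival; it becomes the additive constant of competitiveness.\<close>

definition potential_inv :: "real \<Rightarrow> item list \<Rightarrow> point set set \<Rightarrow> matching \<Rightarrow> bool" where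
  "potential_inv U past \<R> M \<longleftrightarrow>
     (\<Sum>z\<in>set past - Field M. weight z) + (\<Sum>R\<in>\<R>. capacity U (card (waiting past M R)))
       \<le> capacity U 0 + charge U * profit M"

text \<open>Only \<open>R\<close> gains a waiting point, and its capacity drops by at least the
  weight of \<open>x\<close>, so the left-hand side does not grow.\<close>

lemma potential_inv_unmatched:
  assumes U: "U \<ge> 1" and adm: "admissible U B (x # past)" and inv: "geo_inv B past \<R> M"
    and R: "R \<in> \<R>" "pos x \<in> R"
    and rej: "\<And>y. y \<in> waiting past M R \<Longrightarrow> \<not> wam_acceptable U (waiting past M R) x y"
    and pot: "potential_inv U past \<R> M"
  shows "potential_inv U (x # past) \<R> M"
proof -
  let ?c = "\<lambda>past R. capacity U (card (waiting past M R))"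
  have fM: "Field M \<subseteq> set past" and fin: "finite \<R>" and dj: "disjoint \<R>"
    using inv by (auto simp: geo_inv_def)
  have x: "x \<notin> set past" "x \<notin> Field M" using admissible_fresh[OF adm] fM by auto
  have wx: "weight x \<in> {1..U}" using adm by (simp add: admissible_def)
  have "set (x # past) - Field M = insert x (set past - Field M)" using x by auto
  then have unm: "(\<Sum>z\<in>set (x # past) - Field M. weight z) =
      weight x + (\<Sum>z\<in>set past - Field M. weight z)"
    using x by simp
  have same: "waiting (x # past) M R' = waiting past M R'" if "R' \<in> \<R> - {R}" for R'
    using that R dj by (auto simp: waiting_def disjoint_def)
  have "waiting (x # past) M R = insert x (waiting past M R)"
    using R x by (auto simp: waiting_def)
  moreover have "x \<notin> waiting past M R" using x by (simp add: waiting_def)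
  ultimately have "weight x + ?c (x # past) R \<le> ?c past R"
    using capacity_Suc[OF type_of_bounds(1)[OF U wx] few_waiting_if_unmatched[OF adm rej]]
      type_of_bounds(3)[OF U wx] by simp
  moreover have "(\<Sum>R'\<in>\<R>. ?c p R') = ?c p R + (\<Sum>R'\<in>\<R> - {R}. ?c p R')" for p
    using fin R by (intro sum.remove) auto
  moreover have "(\<Sum>R'\<in>\<R> - {R}. ?c (x # past) R') = (\<Sum>R'\<in>\<R> - {R}. ?c past R')"
    by (intro sum.cong) (simp_all add: same)
  ultimately show ?thesis
    using pot unm unfolding potential_inv_def by simp
qed

text \<open>The capacities of the two halves are charged to the weight of the new pair, which is at
  least the threshold of the match type because one of its points has that type.\<close>

lemma potential_inv_matched:
  assumes U: "U powr (1 / real (top_type U)) \<ge> 4" "U \<ge> 1"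
    and adm: "admissible U B (x # past)" and inv: "geo_inv B past \<R> M"
    and R: "R \<in> \<R>" "pos x \<in> R" and y: "y \<in> waiting past M R"
    and acc: "wam_acceptable U (waiting past M R) x y"
    and pot: "potential_inv U past \<R> M"
  shows "potential_inv U (x # past)
    ((\<R> - {R}) \<union> {R \<inter> left_side (pos x) (pos y), R \<inter> right_side (pos x) (pos y)})
    (insert (y, x) M)" (is "potential_inv _ _ (_ \<union> {?A, ?C}) ?M")
proof -
  let ?W = "waiting past M R"
  define c where "c R = capacity U (card (waiting past M R))" for R
  define c' where "c' R = capacity U (card (waiting (x # past) ?M R))" for R
  have fM: "Field M \<subseteq> set past" and fin: "finite \<R>" and dj: "disjoint \<R>"
    using inv by (auto simp: geo_inv_def)
  have x: "x \<notin> set past" "x \<notin> Field M" using admissible_fresh[OF adm] fM by auto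
  have yp: "y \<in> set past" "y \<notin> Field M" "pos y \<in> R" using y by (auto simp: waiting_def)
  have xy: "x \<noteq> y" using x yp by auto
  have finF: "finite (Field M)" using fM finite_subset by blast
  have Field: "Field ?M = insert x (insert y (Field M))" by auto
  have w: "weight z \<in> {1..U}" if "z \<in> set (x # past)" for z
    using adm that unfolding admissible_def by blast
  define i where "i = max (type_of U x) (type_of U y)"
  define m :: nat where "m = 2 ^ (top_type U - i) - 1"
  have i: "i \<le> top_type U" "threshold U i \<le> weight x + weight y"
  proof -
    have "weight x \<in> {1..U}" "weight y \<in> {1..U}" using w yp by auto
    then show "i \<le> top_type U" "threshold U i \<le> weight x + weight y"
      using type_of_bounds(1,2)[OF U(2), of x] type_of_bounds(1,2)[OF U(2), of y]
      by (auto simp: i_def max_def)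
  qed
  have profit: "profit ?M = profit M + (weight x + weight y)"
    using finF x yp xy by (simp add: profit_def Field)
  have "(\<Sum>z\<in>set (x # past) - Field ?M. weight z) \<le> (\<Sum>z\<in>set past - Field M. weight z)"
  proof (intro sum_mono2)
    fix z assume "z \<in> (set past - Field M) - (set (x # past) - Field ?M)"
    then show "0 \<le> weight z" using w[of z] by auto
  qed (auto simp: Field)
  moreover have "(\<Sum>R'\<in>(\<R> - {R}) \<union> {?A, ?C}. c' R') \<le> (\<Sum>R'\<in>\<R>. c R') + charge U * (weight x + weight y)"
  proof -
    have nonneg: "0 \<le> c R'" "0 \<le> c' R'" for R' by (simp_all add: c_def c'_def capacity_nonneg)
    have "waiting (x # past) ?M R' = waiting past M R'" if "R' \<in> \<R> - {R}" for R'
      using that R yp dj by (auto simp: waiting_def disjoint_def Field)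
    then have "(\<Sum>R'\<in>\<R> - {R}. c' R') = (\<Sum>R'\<in>\<R> - {R}. c R')"
      by (intro sum.cong) (simp_all add: c_def c'_def)
    also have "\<dots> \<le> (\<Sum>R'\<in>\<R>. c R')"
      using fin nonneg by (intro sum_mono2) auto
    finally have old: "(\<Sum>R'\<in>\<R> - {R}. c' R') \<le> (\<Sum>R'\<in>\<R>. c R')" .
    \<comment> \<open>The matched points lie on the dividing line, so the waiting points of a half
      are exactly those counted by \<open>wam_acceptable\<close>.\<close>
    have child: "waiting (x # past) ?M (R \<inter> H) = {z \<in> ?W. pos z \<in> H}"
      if "pos x \<notin> H" "pos y \<notin> H" for H
      using that by (auto simp: waiting_def Field)
    have "m \<le> card (waiting (x # past) ?M ?A)" "m \<le> card (waiting (x # past) ?M ?C)"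
      using acc child[of "left_side (pos x) (pos y)"] child[of "right_side (pos x) (pos y)"]
      by (simp_all add: wam_acceptable_def Let_def i_def m_def left_side_def right_side_def
          orient_same)
    then have AC: "c' ?A \<le> capacity U m" "c' ?C \<le> capacity U m"
      unfolding c'_def by (simp_all add: capacity_antimono)
    \<comment> \<open>An empty half may coincide with the other half or with an old region, hence
      the inequalities.\<close>
    have "(\<Sum>R'\<in>(\<R> - {R}) \<union> {?A, ?C}. c' R') \<le> (\<Sum>R'\<in>\<R> - {R}. c' R') + (\<Sum>R'\<in>{?A, ?C}. c' R')"
      using fin nonneg by (subst sum_Un) (auto intro: sum_nonneg)
    also have "(\<Sum>R'\<in>{?A, ?C}. c' R') \<le> c' ?A + c' ?C"
      using nonneg by (cases "?A = ?C") auto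
    also have "c' ?A + c' ?C \<le> 2 * capacity U m" using AC by simp
    also have "2 * capacity U m \<le> charge U * threshold U i"
      using capacity_after_split[OF U(1) i(1)] by (simp add: m_def charge_def mult_ac)
    also have "\<dots> \<le> charge U * (weight x + weight y)"
      using i by (intro mult_left_mono) (auto simp: charge_def)
    finally show ?thesis using old by simp
  qed
  ultimately show ?thesis
    using pot unfolding potential_inv_def profit c_def c'_def by (simp add: ring_distribs)
qed

lemma potential_inv_run:
  assumes bw: "by_weight ord" and U: "U powr (1 / real (top_type U)) \<ge> 4" "U \<ge> 1"
    and adm: "admissible U B past"
  shows "potential_inv U past (fst (wam_run ord U B past)) (snd (wam_run ord U B past))"
  using adm
proof (induction past)
  case Nil
  then show ?case by (simp add: potential_inv_def waiting_def profit_def)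
next
  case (Cons x past)
  obtain \<R> M where st: "wam_run ord U B past = (\<R>, M)" by fastforce
  have pot: "potential_inv U past \<R> M" using Cons admissible_Cons st by fastforce
  have inv: "geo_inv B past \<R> M"
    using geo_inv_run[OF bw admissible_Cons[OF Cons.prems]] st by simp
  show ?case
    using bw Cons.prems inv
  proof (cases rule: wam_step_cases)
    case (unmatched R)
    then show ?thesis
      using potential_inv_unmatched[OF U(2) Cons.prems inv unmatched(1-3) pot] st by simp
  next
    case (matched R y)
    then show ?thesis
      using potential_inv_matched[OF U Cons.prems inv matched(1-4) pot] st by simp
  qed
qed

section \<open>Competitiveness from the potential\<close>

lemma opt_split:
  assumes "by_weight ord" "admissible U B xs"
  shows "opt xs = profit (wam ord U B xs) + (\<Sum>z\<in>set xs - Field (wam ord U B xs). weight z)"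
proof -
  have "distinct xs" using assms by (auto simp: admissible_def distinct_map)
  then have "opt xs = sum weight (set xs)"
    by (simp add: opt_def sum_list_distinct_conv_sum_set)
  moreover have "Field (wam ord U B xs) \<subseteq> set xs"
    using geo_inv_run[OF assms(1), of U B "rev xs"] assms(2)
    by (simp add: admissible_rev wam_def geo_inv_def)
  ultimately show ?thesis
    by (simp add: profit_def sum.subset_diff)
qed

text \<open>The potential bounds the unmatched weight by \<open>capacity U 0\<close> plus
  \<open>charge U\<close> times the profit; adding the profit gives OPT, and dividing by
  \<open>1 + charge U\<close> gives the claim.\<close>

lemma wam_competitive:
  assumes bw: "by_weight ord" and U: "U powr (1 / real (top_type U)) \<ge> 4" "U \<ge> 1"
  shows "competitive U (wam ord U) (1 / (1 + charge U))"
  unfolding competitive_def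
proof (intro exI[of _ "capacity U 0 / (1 + charge U)"] allI impI)
  fix B xs assume "input U B xs"
  then have adm: "admissible U B xs" by (simp add: input_def)
  have "potential_inv U (rev xs) (fst (wam_run ord U B (rev xs))) (wam ord U B xs)"
    using potential_inv_run[OF bw U, of B "rev xs"] adm by (simp add: admissible_rev wam_def)
  moreover have "0 \<le> (\<Sum>R\<in>fst (wam_run ord U B (rev xs)).
      capacity U (card (waiting (rev xs) (wam ord U B xs) R)))"
    by (intro sum_nonneg capacity_nonneg)
  ultimately have "opt xs \<le> capacity U 0 + (1 + charge U) * profit (wam ord U B xs)"
    using opt_split[OF bw adm] by (simp add: potential_inv_def ring_distribs)
  moreover have "charge U \<ge> 0" by (simp add: charge_def)
  ultimately show "1 / (1 + charge U) * opt xs - capacity U 0 / (1 + charge U)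
      \<le> profit (wam ord U B xs)"
    by (simp add: diff_divide_distrib[symmetric] divide_le_eq mult.commute)
qed

section \<open>Boundedness of the set of competitive factors\<close>

lemma large_input:
  assumes U: "U \<ge> 1"
  shows "\<exists>B xs. input U B xs \<and> opt xs = 2 * real n"
proof -
  \<comment> \<open>Points on a parabola are in general position: the orientation of three of them
    is a Vandermonde product.\<close>
  define f :: "nat \<Rightarrow> point" where "f i = vector [real i, (real i)\<^sup>2]" for i
  define xs where "xs = map (\<lambda>i. (f i, 1::real)) [0..<2 * n]"
  have inj: "inj f" by (auto simp: inj_def f_def vec_eq_iff forall_2)
  have orient: "orient (f a) (f b) (f c) = (real b - real a) * (real c - real a) * (real c - real b)"
    for a b c by (simp add: orient_def f_def algebra_simps power2_eq_square)
  have gp: "general_position (range f)"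
    unfolding general_position_def orient_eq_0_iff[symmetric] by (auto simp: orient)
  have "bounded (f ` {0..<2 * n})" by (intro finite_imp_bounded) simp
  then obtain h where h: "f ` {0..<2 * n} \<subseteq> cbox (- h) h"
    using bounded_subset_cbox_symmetric by blast
  have "input U (cbox (- h) h) xs"
    unfolding input_def admissible_def
  proof (intro conjI)
    show "distinct (map pos xs)"
      using inj by (simp add: xs_def distinct_map o_def inj_on_def inj_def)
    show "general_position (pos ` set xs)"
      using gp by (auto simp: general_position_def xs_def)
  qed (use h U in \<open>auto simp: is_box_def xs_def\<close>)
  moreover have "opt xs = 2 * real n"
    by (simp add: opt_def xs_def o_def sum_list_triv)
  ultimately show ?thesis by blast
qed

text \<open>Profit never exceeds OPT, so a factor above 1 would bound OPT by a constant, against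
  \<open>large_input\<close>. The bound ensures that the \<open>Sup\<close> in
  \<open>competitive_ratio\<close> is taken over a bounded set.\<close>

lemma competitive_le_1:
  assumes bw: "by_weight ord" and U: "U \<ge> 1" and comp: "competitive U (wam ord U) \<rho>"
  shows "\<rho> \<le> 1"
proof (rule ccontr)
  assume "\<not> \<rho> \<le> 1"
  then have pos: "\<rho> - 1 > 0" by simp
  obtain c where c: "\<And>B xs. input U B xs \<Longrightarrow> \<rho> * opt xs - c \<le> profit (wam ord U B xs)"
    using comp by (auto simp: competitive_def)
  obtain n :: nat where n: "c < real n * (\<rho> - 1)"
    using reals_Archimedean3[OF pos] by blast
  obtain B xs where xs: "input U B xs" "opt xs = 2 * real n"
    using large_input[OF U] by blast
  have adm: "admissible U B xs" using xs by (simp add: input_def)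
  have "0 \<le> (\<Sum>z\<in>set xs - Field (wam ord U B xs). weight z)"
    using adm by (intro sum_nonneg) (fastforce simp: admissible_def)
  then have "profit (wam ord U B xs) \<le> 2 * real n"
    using opt_split[OF bw adm] xs by simp
  then have "2 * (real n * (\<rho> - 1)) \<le> c"
    using c[OF xs(1)] xs(2) by (simp add: algebra_simps)
  moreover have "0 \<le> real n * (\<rho> - 1)" using pos by simp
  ultimately show False using n by linarith
qed

lemma competitive_ratio_ge:
  assumes "by_weight ord" "U powr (1 / real (top_type U)) \<ge> 4" "U \<ge> 1"
  shows "1 / (1 + charge U) \<le> competitive_ratio U (wam ord U)"
  unfolding competitive_ratio_def
proof (rule cSup_upper)
  show "bdd_above {\<rho>. competitive U (wam ord U) \<rho>}"
    by (rule bdd_aboveI[of _ 1]) (rule competitive_le_1[OF assms(1,3)], rule CollectD)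
  show "1 / (1 + charge U) \<in> {\<rho>. competitive U (wam ord U) \<rho>}"
    using wam_competitive[OF assms] by (rule CollectI)
qed

section \<open>Asymptotics for large \<open>U\<close>\<close>

lemma charge_bounds:
  assumes U: "U \<ge> 512"
  shows "U powr (1 / real (top_type U)) \<ge> 4"
    and "1 + charge U \<le> 17 * 2 powr (2 * sqrt (log 2 U))"
proof -
  define s where "s = sqrt (log 2 U)"
  define k where "k = top_type U"
  \<comment> \<open>The bound 512 gives \<open>s \<ge> 3\<close>, which suffices for
    \<open>2 * k \<le> 3 * s \<le> s * s\<close> and so for a base of at least 4.\<close>
  have "log 2 512 \<le> log 2 U" using U by simp
  moreover have "log 2 512 = (9::real)"
    using log_pow_cancel[of 2 9] by simp
  ultimately have L: "log 2 U \<ge> 9" by simp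
  then have s3: "s \<ge> 3" unfolding s_def by (intro real_le_rsqrt) simp
  have U2: "U = 2 powr (s * s)" using L U by (simp add: s_def)
  have ks: "s \<le> real k" "real k \<le> s + 1"
    using s3 unfolding k_def top_type_def s_def[symmetric] by linarith+
  have r: "U powr (1 / real k) = 2 powr (s * s / real k)"
    unfolding U2 by (simp add: powr_powr)
  have "2 * real k \<le> 3 * s" using ks s3 by simp
  also have "3 * s \<le> s * s" using s3 by (intro mult_right_mono) auto
  finally have "2 * real k \<le> s * s" .
  then have "2 \<le> s * s / real k" using ks s3 by (simp add: le_divide_eq)
  then have "2 powr 2 \<le> U powr (1 / real k)" unfolding r by (intro powr_mono) auto
  then show "U powr (1 / real (top_type U)) \<ge> 4" by (simp add: k_def)
  have "s * s / real k \<le> s"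
    using ks s3 by (simp add: divide_le_eq mult_left_mono)
  then have r_le: "U powr (1 / real k) \<le> 2 powr s" unfolding r by (intro powr_mono) auto
  \<comment> \<open>Rounding \<open>k\<close> up costs one factor 2, so the 8 in
    \<open>charge\<close> becomes 16; the summand 1 then makes 17.\<close>
  have "(2::real) ^ k = 2 powr real k" by (simp add: powr_realpow)
  also have "\<dots> \<le> 2 powr (s + 1)" using ks by (intro powr_mono) auto
  also have "\<dots> = 2 * 2 powr s" by (simp add: powr_add)
  finally have "2 ^ k * U powr (1 / real k) \<le> (2 * 2 powr s) * 2 powr s"
    using r_le by (intro mult_mono) auto
  also have "\<dots> = 2 * 2 powr (2 * s)" by (simp add: powr_add[symmetric])
  finally have "charge U \<le> 16 * 2 powr (2 * s)" by (simp add: charge_def k_def)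
  moreover have "1 \<le> 2 powr (2 * s)" using s3 by (intro ge_one_powr_ge_zero) auto
  ultimately show "1 + charge U \<le> 17 * 2 powr (2 * sqrt (log 2 U))"
    by (simp add: s_def)
qed

theorem theorem7:
  fixes ord :: consideration_order
  assumes "by_weight ord"
  shows "(\<forall>U\<ge>1. online_algorithm U (wam ord U)) \<and>
    (\<lambda>U::real. competitive_ratio U (wam ord U)) \<in> \<Omega>(\<lambda>U. 2 powr (- 2 * sqrt (log 2 U)))"
proof
  show "\<forall>U\<ge>1. online_algorithm U (wam ord U)"
    using online_wam[OF assms] by blast
  show "(\<lambda>U::real. competitive_ratio U (wam ord U)) \<in> \<Omega>(\<lambda>U. 2 powr (- 2 * sqrt (log 2 U)))"
  proof (rule landau_omega.bigI[of "1 / 17"])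
    show "\<forall>\<^sub>F U in at_top. norm (competitive_ratio U (wam ord U))
        \<ge> 1 / 17 * norm (2 powr (- 2 * sqrt (log 2 U)))"
      using eventually_ge_at_top[of 512]
    proof eventually_elim
      case (elim U)
      have "charge U \<ge> 0" by (simp add: charge_def)
      have "1 / 17 * 2 powr (- 2 * sqrt (log 2 U)) = 1 / (17 * 2 powr (2 * sqrt (log 2 U)))"
        by (simp add: powr_minus_divide)
      also have "\<dots> \<le> 1 / (1 + charge U)"
        using charge_bounds(2)[OF elim] \<open>charge U \<ge> 0\<close> by (intro divide_left_mono) auto
      also have "\<dots> \<le> competitive_ratio U (wam ord U)"
        using elim by (intro competitive_ratio_ge assms charge_bounds) auto
      finally show ?case by simp
    qed
  qed simp
qed

end
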